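(* The Gaussian and mean curvatures of an admissible parabolic revolution surface of ni-type in $\mathbb{I}^3$, $$Y_3(u,t)=\left(at+x(u),\ bt+y(u),\ ct+\tfrac{ac_1+bc_2}{2}t^2+c_1t\,x(u)+c_2t\,y(u)\right),$$ with $C^2$ generating curve $\alpha(u)=(x(u),y(u),0)$, are respectively $$K=\frac{(ac_1+bc_2)(c+c_1x+c_2y)(x''y'-x'y'')}{(bx'-ay')^3}-\left(\frac{c_1x'+c_2y'}{bx'-ay'}\right)^2$$ and $$H=\frac{(a^2+b^2)(c+c_1x+c_2y)(x''y'-x'y'')}{2(bx'-ay')^3}-\frac{(ax'+by')(c_1x'+c_2y')}{(bx'-ay')^2}+\frac{(x'^2+y'^2)(ac_1+bc_2)}{2(bx'-ay')^2}.$$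
   Context: Here $a,b,c,c_1,c_2\in\mathbb{R}$ are constants with $ac_1+bc_2\neq0$ (the defining condition of parabolic rotations), and primes denote $d/du$. The simply isotropic space $\mathbb{I}^3$ is $\mathbb{R}^3$ with the degenerate metric $\langle u,v\rangle_z=u^1v^1+u^2v^2$. For a $C^2$ parameterized surface $\mathbf{x}(u^1,u^2)=(x^1,x^2,x^3)$ write $\mathbf{x}_i=\partial\mathbf{x}/\partial u^i$, $\mathbf{x}_{ij}=\partial^2\mathbf{x}/\partial u^i\partial u^j$, $x^i_k=\partial x^i/\partial u^k$, $X_{ij}=x^i_1x^j_2-x^j_1x^i_2$. The surface is admissible if $X_{12}\neq0$ (equivalently, the induced metric has rank 2). Put $g_{ij}=\langle\mathbf{x}_i,\mathbf{x}_j\rangle_z$, $N_h=\left(\frac{X_{23}}{X_{12}},\frac{X_{31}}{X_{12}},1\right)$, $h_{ij}=\langle N_h,\mathbf{x}_{ij}\rangle$ (Euclidean inner product). The Gaussian and mean curvatures are $$K=\frac{h_{11}h_{22}-h_{12}^2}{g_{11}g_{22}-g_{12}^2},\qquad H=\frac12\,\frac{g_{11}h_{22}-2g_{12}h_{12}+g_{22}h_{11}}{g_{11}g_{22}-g_{12}^2};$$ equivalently $K=\det L$, $H=\frac12\mathrm{tr}\,L$ with $L=-D\xi$, $\xi=\left(A,B,\frac12(1-A^2-B^2)\right)$, $A=X_{23}/X_{12}$, $B=X_{31}/X_{12}$. For the surface in the claim the coordinates are $(u^1,u^2)=(u,t)$. *)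

theory Defs
  imports "HOL-Analysis.Analysis"
begin

section \<open>Curves of class C2 and partial derivatives\<close>

text \<open>Derivatives are two-sided at every point of \<open>I\<close>, so this is the usual notion for open \<open>I\<close>.\<close>

definition C2_on :: "real set \<Rightarrow> (real \<Rightarrow> 'a::real_normed_vector) \<Rightarrow> bool" where
  "C2_on I f \<longleftrightarrow> f C1_differentiable_on I \<and>
     (\<lambda>u. vector_derivative f (at u)) C1_differentiable_on I"

definition pderivative :: "'n::finite \<Rightarrow> (real^'n \<Rightarrow> 'a::real_normed_vector) \<Rightarrow> real^'n \<Rightarrow> 'a" where
  "pderivative i f p = vector_derivative (\<lambda>s. f (p + s *\<^sub>R axis i 1)) (at 0)"

section \<open>Surfaces in the simply isotropic space\<close>

text \<open>The simply isotropic space is \<^typ>\<open>real^3\<close> with the degenerate metric below. A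
  parameterized surface is a map \<^typ>\<open>real^2 \<Rightarrow> real^3\<close>, considered on an open parameter domain;
  all quantities below are evaluated at a parameter point.\<close>

definition iso_inner :: "real^3 \<Rightarrow> real^3 \<Rightarrow> real" where
  "iso_inner v w = v$1 * w$1 + v$2 * w$2"

text \<open>The minors $X_{ij} = x^i_1 x^j_2 - x^j_1 x^i_2$ of the Jacobian matrix.\<close>

definition minor :: "(real^2 \<Rightarrow> real^3) \<Rightarrow> 3 \<Rightarrow> 3 \<Rightarrow> real^2 \<Rightarrow> real" where
  "minor X i j p =
     pderivative 1 X p $ i * pderivative 2 X p $ j - pderivative 1 X p $ j * pderivative 2 X p $ i"

definition admissible_on :: "(real^2) set \<Rightarrow> (real^2 \<Rightarrow> real^3) \<Rightarrow> bool" where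
  "admissible_on U X \<longleftrightarrow> (\<forall>p\<in>U. minor X 1 2 p \<noteq> 0)"

definition first_form :: "(real^2 \<Rightarrow> real^3) \<Rightarrow> 2 \<Rightarrow> 2 \<Rightarrow> real^2 \<Rightarrow> real" where
  "first_form X i j p = iso_inner (pderivative i X p) (pderivative j X p)"

definition normal_h :: "(real^2 \<Rightarrow> real^3) \<Rightarrow> real^2 \<Rightarrow> real^3" where
  "normal_h X p = vector [minor X 2 3 p / minor X 1 2 p, minor X 3 1 p / minor X 1 2 p, 1]"

definition second_form :: "(real^2 \<Rightarrow> real^3) \<Rightarrow> 2 \<Rightarrow> 2 \<Rightarrow> real^2 \<Rightarrow> real" where
  "second_form X i j p = normal_h X p \<bullet> pderivative i (pderivative j X) p"

definition gauss_curvature :: "(real^2 \<Rightarrow> real^3) \<Rightarrow> real^2 \<Rightarrow> real" where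
  "gauss_curvature X p =
     (second_form X 1 1 p * second_form X 2 2 p - (second_form X 1 2 p)\<^sup>2) /
     (first_form X 1 1 p * first_form X 2 2 p - (first_form X 1 2 p)\<^sup>2)"

definition mean_curvature :: "(real^2 \<Rightarrow> real^3) \<Rightarrow> real^2 \<Rightarrow> real" where
  "mean_curvature X p = 1 / 2 *
     ((first_form X 1 1 p * second_form X 2 2 p - 2 * first_form X 1 2 p * second_form X 1 2 p
        + first_form X 2 2 p * second_form X 1 1 p) /
      (first_form X 1 1 p * first_form X 2 2 p - (first_form X 1 2 p)\<^sup>2))"

section \<open>Parabolic revolution surfaces of ni-type\<close>

text \<open>The orbit of the curve \<open>(x, y, 0)\<close> in the non-isotropic plane \<open>z = 0\<close> under the
  one-parameter group (parameter \<open>t\<close>) of parabolic rotations with constants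
  \<open>a, b, c, c1, c2\<close>; the coordinates of the parameter point are \<open>(u, t)\<close>.\<close>

definition parabolic_ni_surface ::
  "real \<Rightarrow> real \<Rightarrow> real \<Rightarrow> real \<Rightarrow> real \<Rightarrow> (real \<Rightarrow> real) \<Rightarrow> (real \<Rightarrow> real) \<Rightarrow> real^2 \<Rightarrow> real^3" where
  "parabolic_ni_surface a b c c1 c2 x y p = (let u = p$1; t = p$2 in
     vector [a * t + x u,
             b * t + y u,
             c * t + (a * c1 + b * c2) / 2 * t\<^sup>2 + c1 * t * x u + c2 * t * y u])"

end

theory Submission imports Defs begin

text \<open>Write \<open>W = b x' - a y'\<close> and \<open>m = a c1 + b c2\<close>. The surface is quadratic in \<open>t\<close>, with
  coefficients depending on \<open>u\<close> through the curve, so its partial derivatives can be read off.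
  Each of the first two coordinates is a linear function of \<open>t\<close> plus a function of \<open>u\<close>, so
  the second derivatives \<open>X\<^sub>u\<^sub>t\<close> and \<open>X\<^sub>t\<^sub>t\<close> are vertical, and the third component of \<open>N\<^sub>h\<close> is 1;
  hence \<open>h\<^sub>1\<^sub>2 = c1 x' + c2 y'\<close> and \<open>h\<^sub>2\<^sub>2 = m\<close>.
  Likewise \<open>g\<^sub>1\<^sub>1 = x'\<^sup>2 + y'\<^sup>2\<close>, \<open>g\<^sub>1\<^sub>2 = a x' + b y'\<close> and \<open>g\<^sub>2\<^sub>2 = a\<^sup>2 + b\<^sup>2\<close>, so Lagrange's
  identity gives the determinant \<open>W\<^sup>2\<close> of the first form, and admissibility says \<open>W \<noteq> 0\<close>.

  The only entry where \<open>t\<close> could survive is \<open>h\<^sub>1\<^sub>1\<close>. The group of parabolic rotations acts by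
  isotropic motions and its orbits are the \<open>t\<close>-lines, so \<open>h\<^sub>1\<^sub>1\<close> cannot depend on \<open>t\<close>;
  concretely, the terms linear in \<open>t\<close> cancel by an identity for
  \<open>2 \<times> 2\<close> determinants (\<open>second_form_11_parabolic_ni\<close>), leaving
  \<open>h\<^sub>1\<^sub>1 = (c + c1 x + c2 y) (x'' y' - x' y'') / W\<close>. Substituting the six entries into the
  definitions of the curvatures yields the claim.\<close>

section \<open>Derivatives of twice differentiable curves\<close>

lemma has_vector_derivative_vector_3:
  fixes f g h :: "real \<Rightarrow> real"
  assumes "(f has_real_derivative f') F" "(g has_real_derivative g') F"
    "(h has_real_derivative h') F" and F: "F = at u within S"
  shows "((\<lambda>s. vector [f s, g s, h s] :: real^3) has_vector_derivative vector [f', g', h']) F"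
proof -
  have split: "(vector [p, q, r] :: real^3) =
      p *\<^sub>R axis 1 1 + q *\<^sub>R axis 2 1 + r *\<^sub>R axis 3 1" for p q r
    by (simp add: vec_eq_iff forall_3 axis_def)
  show ?thesis
    unfolding split F using assms(1-3)[unfolded F]
    by (auto intro!: derivative_eq_intros simp: has_real_derivative_iff_has_vector_derivative)
qed

text \<open>On an open set, the derivative of the curve is a genuine derivative at nearby points, so
  the second derivative can be taken componentwise.\<close>

lemma C2_on_component:
  fixes f :: "real \<Rightarrow> real^'n"
  assumes C2: "C2_on I f" and I: "open I" "u \<in> I"
  shows "((\<lambda>s. f s $ k) has_real_derivative deriv (\<lambda>s. f s $ k) u) (at u)"
    and "(deriv (\<lambda>s. f s $ k) has_real_derivative deriv (deriv (\<lambda>s. f s $ k)) u) (at u)"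
proof -
  define f' where "f' = (\<lambda>s. vector_derivative f (at s))"
  have f': "(f has_vector_derivative f' v) (at v)" if "v \<in> I" for v
    using C2 that unfolding C2_on_def C1_differentiable_on_def f'_def
    by (metis vector_derivative_at)
  obtain f'' where f'': "(f' has_vector_derivative f'') (at u)"
    using C2 I unfolding C2_on_def C1_differentiable_on_def f'_def by metis
  have comp: "((\<lambda>s. g s $ k) has_real_derivative g' $ k) (at v)"
    if "(g has_vector_derivative g') (at v)" for g :: "real \<Rightarrow> real^'n" and g' v
    unfolding has_real_derivative_iff_has_vector_derivative
    by (rule bounded_linear.has_vector_derivative[OF bounded_linear_vec_nth that])
  have d: "deriv (\<lambda>s. f s $ k) v = f' v $ k" if "v \<in> I" for v
    by (rule DERIV_imp_deriv[OF comp[OF f'[OF that]]])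
  show "((\<lambda>s. f s $ k) has_real_derivative deriv (\<lambda>s. f s $ k) u) (at u)"
    using comp[OF f'[OF I(2)]] d[OF I(2)] by simp
  have "(deriv (\<lambda>s. f s $ k) has_real_derivative f'' $ k) (at u)"
    by (rule has_field_derivative_transform_within_open[OF comp[OF f''] I]) (simp add: d)
  then show "(deriv (\<lambda>s. f s $ k) has_real_derivative deriv (deriv (\<lambda>s. f s $ k)) u) (at u)"
    using DERIV_imp_deriv by force
qed

section \<open>Partial derivatives along coordinate lines\<close>

lemma has_vector_derivative_shift_at_0:
  fixes f :: "real \<Rightarrow> 'a::real_normed_vector"
  assumes "(f has_vector_derivative D) (at r)"
  shows "((\<lambda>s. f (s + r)) has_vector_derivative D) (at 0)"
proof -
  have "((\<lambda>s. s + r) has_vector_derivative 1) (at 0)"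
    by (auto intro!: derivative_eq_intros)
  from vector_diff_chain_at[OF this, of f D] assms show ?thesis
    by (simp add: o_def)
qed

lemma pderivative_1_eq:
  assumes "((\<lambda>v. F (vector [v, t])) has_vector_derivative D) (at u)"
  shows "pderivative 1 F (vector [u, t] :: real^2) = D"
proof -
  have line: "vector [u, t] + s *\<^sub>R axis 1 1 = (vector [s + u, t] :: real^2)" for s
    by (simp add: vec_eq_iff forall_2 axis_def)
  have "((\<lambda>s. F (vector [s + u, t])) has_vector_derivative D) (at 0)"
    by (rule has_vector_derivative_shift_at_0[OF assms])
  then show ?thesis
    unfolding pderivative_def line by (rule vector_derivative_at)
qed

lemma pderivative_2_eq:
  assumes "((\<lambda>v. F (vector [u, v])) has_vector_derivative D) (at t)"
  shows "pderivative 2 F (vector [u, t] :: real^2) = D"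
proof -
  have line: "vector [u, t] + s *\<^sub>R axis 2 1 = (vector [u, s + t] :: real^2)" for s
    by (simp add: vec_eq_iff forall_2 axis_def)
  have "((\<lambda>s. F (vector [u, s + t])) has_vector_derivative D) (at 0)"
    by (rule has_vector_derivative_shift_at_0[OF assms])
  then show ?thesis
    unfolding pderivative_def line by (rule vector_derivative_at)
qed

section \<open>The fundamental forms of the surface\<close>

text \<open>The locale collects exactly the differentiability of the coordinate functions that the
  partial derivatives up to order two require.\<close>

locale twice_differentiable_generating_curve =
  fixes a b c c1 c2 :: real and x y :: "real \<Rightarrow> real" and I :: "real set"
  assumes open_I: "open I"
    and x': "u \<in> I \<Longrightarrow> (x has_real_derivative deriv x u) (at u)"
    and y': "u \<in> I \<Longrightarrow> (y has_real_derivative deriv y u) (at u)"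
    and x'': "u \<in> I \<Longrightarrow> (deriv x has_real_derivative deriv (deriv x) u) (at u)"
    and y'': "u \<in> I \<Longrightarrow> (deriv y has_real_derivative deriv (deriv y) u) (at u)"
begin

abbreviation X where "X \<equiv> parabolic_ni_surface a b c c1 c2 x y"

lemma surface_eq:
  "X (vector [u, t]) = vector [a * t + x u, b * t + y u,
     c * t + (a * c1 + b * c2) / 2 * t\<^sup>2 + c1 * t * x u + c2 * t * y u]"
  by (simp add: parabolic_ni_surface_def)

lemma pderivative_surface_1:
  assumes "u \<in> I"
  shows "pderivative 1 X (vector [u, t]) =
    vector [deriv x u, deriv y u, t * (c1 * deriv x u + c2 * deriv y u)]"
  using x'[OF assms] y'[OF assms]
  by (intro pderivative_1_eq)
    (auto simp: surface_eq algebra_simps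
      intro!: derivative_eq_intros has_vector_derivative_vector_3[OF _ _ _ refl])

lemma pderivative_surface_2:
  "pderivative 2 X (vector [u, t]) =
    vector [a, b, c + (a * c1 + b * c2) * t + c1 * x u + c2 * y u]"
  by (intro pderivative_2_eq)
    (auto simp: surface_eq algebra_simps
      intro!: derivative_eq_intros has_vector_derivative_vector_3[OF _ _ _ refl])

lemma pderivative_surface_11:
  assumes "u \<in> I"
  shows "pderivative 1 (pderivative 1 X) (vector [u, t]) =
    vector [deriv (deriv x) u, deriv (deriv y) u,
      t * (c1 * deriv (deriv x) u + c2 * deriv (deriv y) u)]"
proof (rule pderivative_1_eq)
  let ?D = "\<lambda>v. vector [deriv x v, deriv y v, t * (c1 * deriv x v + c2 * deriv y v)] :: real^3"
  have "(?D has_vector_derivative vector [deriv (deriv x) u, deriv (deriv y) u,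
      t * (c1 * deriv (deriv x) u + c2 * deriv (deriv y) u)]) (at u)"
    using x''[OF assms] y''[OF assms]
    by (auto simp: algebra_simps
      intro!: derivative_eq_intros has_vector_derivative_vector_3[OF _ _ _ refl])
  then show "((\<lambda>v. pderivative 1 X (vector [v, t])) has_vector_derivative
      vector [deriv (deriv x) u, deriv (deriv y) u,
      t * (c1 * deriv (deriv x) u + c2 * deriv (deriv y) u)]) (at u)"
    by (rule has_vector_derivative_transform_within_open[OF _ open_I assms])
      (simp add: pderivative_surface_1)
qed

lemma pderivative_surface_12:
  assumes "u \<in> I"
  shows "pderivative 1 (pderivative 2 X) (vector [u, t]) =
    vector [0, 0, c1 * deriv x u + c2 * deriv y u]"
  using x'[OF assms] y'[OF assms]
  by (intro pderivative_1_eq)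
    (auto simp: pderivative_surface_2
      intro!: derivative_eq_intros has_vector_derivative_vector_3[OF _ _ _ refl])

lemma pderivative_surface_22:
  "pderivative 2 (pderivative 2 X) (vector [u, t]) = vector [0, 0, a * c1 + b * c2]"
  by (intro pderivative_2_eq)
    (auto simp: pderivative_surface_2
      intro!: derivative_eq_intros has_vector_derivative_vector_3[OF _ _ _ refl])

lemma minor_12_parabolic_ni:
  assumes "u \<in> I"
  shows "minor X 1 2 (vector [u, t]) = b * deriv x u - a * deriv y u"
  using assms by (simp add: minor_def pderivative_surface_1 pderivative_surface_2)

lemma first_form_parabolic_ni:
  assumes "u \<in> I"
  shows "first_form X 1 1 (vector [u, t]) = (deriv x u)\<^sup>2 + (deriv y u)\<^sup>2"
    and "first_form X 1 2 (vector [u, t]) = a * deriv x u + b * deriv y u"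
    and "first_form X 2 2 (vector [u, t]) = a\<^sup>2 + b\<^sup>2"
  using assms by (simp_all add: first_form_def iso_inner_def power2_eq_square
      pderivative_surface_1 pderivative_surface_2)

text \<open>The parameter \<open>t\<close> enters linearly through the minors with index 3 and through the third
  component of \<open>X\<^sub>u\<^sub>u\<close>. With the linear forms \<open>l(v) = c1 v\<^sup>1 + c2 v\<^sup>2\<close> and
  \<open>w(v) = b v\<^sup>1 - a v\<^sup>2\<close> on the plane, the terms of the second kind and those of the minors
  containing \<open>l(\<alpha>')\<close> combine to \<open>l(\<alpha>'') w(\<alpha>') - l(\<alpha>') w(\<alpha>'')\<close>. This expression is the product
  of the determinant \<open>- (a c1 + b c2)\<close> of the two forms with \<open>det(\<alpha>'', \<alpha>')\<close>, which is what the
  summand \<open>(a c1 + b c2) t\<close> of the third component of \<open>X\<^sub>t\<close> cancels.\<close>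

lemma second_form_11_parabolic_ni:
  assumes "u \<in> I" and W: "b * deriv x u - a * deriv y u \<noteq> 0"
  shows "second_form X 1 1 (vector [u, t]) = (c + c1 * x u + c2 * y u) *
    (deriv (deriv x) u * deriv y u - deriv x u * deriv (deriv y) u) /
    (b * deriv x u - a * deriv y u)"
proof -
  define p q p' q' W where "p = deriv x u" and "q = deriv y u" and "p' = deriv (deriv x) u"
    and "q' = deriv (deriv y) u" and "W = b * deriv x u - a * deriv y u"
  have W0: "W \<noteq> 0"
    using W by (simp add: W_def)
  define Q where "Q = c + (a * c1 + b * c2) * t + c1 * x u + c2 * y u"
  have cancel: "(c1 * p' + c2 * q') * W - (c1 * p + c2 * q) * (b * p' - a * q') =
      - (a * c1 + b * c2) * (p' * q - p * q')"
    by (simp add: W_def p_def q_def algebra_simps)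
  have "second_form X 1 1 (vector [u, t]) =
      (q * Q - t * (c1 * p + c2 * q) * b) / W * p' +
      (t * (c1 * p + c2 * q) * a - p * Q) / W * q' + t * (c1 * p' + c2 * q')"
    using minor_12_parabolic_ni[OF assms(1)] assms(1)
    by (simp add: second_form_def normal_h_def inner_vec_def sum_3
        pderivative_surface_11 p_def q_def p'_def q'_def W_def)
      (simp add: minor_def pderivative_surface_1 pderivative_surface_2 Q_def mult_ac)
  also have "\<dots> = (Q * (p' * q - p * q') +
      t * ((c1 * p' + c2 * q') * W - (c1 * p + c2 * q) * (b * p' - a * q'))) / W"
    using W0 by (simp add: field_simps)
  also have "\<dots> = (c + c1 * x u + c2 * y u) * (p' * q - p * q') / W"
    unfolding cancel by (simp add: Q_def algebra_simps)
  finally show ?thesis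
    by (simp add: p_def q_def p'_def q'_def W_def)
qed

lemma second_form_12_parabolic_ni:
  assumes "u \<in> I"
  shows "second_form X 1 2 (vector [u, t]) = c1 * deriv x u + c2 * deriv y u"
  using assms
  by (simp add: second_form_def normal_h_def inner_vec_def sum_3 pderivative_surface_12)

lemma second_form_22_parabolic_ni:
  "second_form X 2 2 (vector [u, t]) = a * c1 + b * c2"
  by (simp add: second_form_def normal_h_def inner_vec_def sum_3 pderivative_surface_22)

end

section \<open>The curvatures\<close>

theorem proposition5p3:
  fixes a b c c1 c2 :: real
    and x y :: "real \<Rightarrow> real"
    and I :: "real set"
  assumes parabolic: "a * c1 + b * c2 \<noteq> 0"
    and I: "open I" "is_interval I"
    and curve: "C2_on I (\<lambda>u. vector [x u, y u, 0] :: real^3)"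
    and admissible: "admissible_on {p. p$1 \<in> I} (parabolic_ni_surface a b c c1 c2 x y)"
  shows "\<forall>u\<in>I. \<forall>t.
    gauss_curvature (parabolic_ni_surface a b c c1 c2 x y) (vector [u, t]) =
      (a * c1 + b * c2) * (c + c1 * x u + c2 * y u) *
        (deriv (deriv x) u * deriv y u - deriv x u * deriv (deriv y) u) /
        (b * deriv x u - a * deriv y u) ^ 3
      - ((c1 * deriv x u + c2 * deriv y u) / (b * deriv x u - a * deriv y u))\<^sup>2 \<and>
    mean_curvature (parabolic_ni_surface a b c c1 c2 x y) (vector [u, t]) =
      (a\<^sup>2 + b\<^sup>2) * (c + c1 * x u + c2 * y u) *
        (deriv (deriv x) u * deriv y u - deriv x u * deriv (deriv y) u) /
        (2 * (b * deriv x u - a * deriv y u) ^ 3)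
      - (a * deriv x u + b * deriv y u) * (c1 * deriv x u + c2 * deriv y u) /
        (b * deriv x u - a * deriv y u)\<^sup>2
      + ((deriv x u)\<^sup>2 + (deriv y u)\<^sup>2) * (a * c1 + b * c2) /
        (2 * (b * deriv x u - a * deriv y u)\<^sup>2)"
proof (intro ballI allI)
  fix u t assume u: "u \<in> I"
  interpret twice_differentiable_generating_curve a b c c1 c2 x y I
    using C2_on_component[OF curve I(1), where k = 1] C2_on_component[OF curve I(1), where k = 2]
    by unfold_locales (simp_all add: I)
  define W where "W = b * deriv x u - a * deriv y u"
  have "minor X 1 2 (vector [u, t]) \<noteq> 0"
    using admissible u unfolding admissible_on_def by simp
  then have W: "W \<noteq> 0"
    using minor_12_parabolic_ni[OF u] by (simp add: W_def)
  have lagrange: "((deriv x u)\<^sup>2 + (deriv y u)\<^sup>2) * (a\<^sup>2 + b\<^sup>2) -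
      (a * deriv x u + b * deriv y u)\<^sup>2 = W\<^sup>2"
    unfolding W_def by algebra
  note forms = first_form_parabolic_ni[OF u] second_form_12_parabolic_ni[OF u]
    second_form_22_parabolic_ni second_form_11_parabolic_ni[OF u W[unfolded W_def]]
  show "gauss_curvature X (vector [u, t]) =
      (a * c1 + b * c2) * (c + c1 * x u + c2 * y u) *
        (deriv (deriv x) u * deriv y u - deriv x u * deriv (deriv y) u) /
        (b * deriv x u - a * deriv y u) ^ 3
      - ((c1 * deriv x u + c2 * deriv y u) / (b * deriv x u - a * deriv y u))\<^sup>2 \<and>
    mean_curvature X (vector [u, t]) =
      (a\<^sup>2 + b\<^sup>2) * (c + c1 * x u + c2 * y u) *
        (deriv (deriv x) u * deriv y u - deriv x u * deriv (deriv y) u) /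
        (2 * (b * deriv x u - a * deriv y u) ^ 3)
      - (a * deriv x u + b * deriv y u) * (c1 * deriv x u + c2 * deriv y u) /
        (b * deriv x u - a * deriv y u)\<^sup>2
      + ((deriv x u)\<^sup>2 + (deriv y u)\<^sup>2) * (a * c1 + b * c2) /
        (2 * (b * deriv x u - a * deriv y u)\<^sup>2)"
    unfolding gauss_curvature_def mean_curvature_def forms lagrange W_def[symmetric]
    using W by (simp add: field_simps power2_eq_square power3_eq_cube)
qed

end
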